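(* Let $m$ be an odd positive integer and let $F:\mathbb{F}_{2^m}^3\to\mathbb{F}_{2^m}^3$ be defined by $F(x,y,z)=(f(x,y,z),f(y,z,x),f(z,x,y))$, where $f(x,y,z)=x^3+x^2y+xy^2+x^2z+xz^2$. Then $F$ is a permutation of $\mathbb{F}_{2^m}^3$.
   Context: $\mathbb{F}_{2^m}$ denotes the finite field with $2^m$ elements and $\mathbb{F}_{2^m}^3$ the 3-dimensional vector space over it. A permutation of $\mathbb{F}_{2^m}^3$ is a bijection from $\mathbb{F}_{2^m}^3$ to itself. *)

theory Defs
  imports "HOL-Library.Cardinality"
begin

definition f_poly :: "'a::field \<Rightarrow> 'a \<Rightarrow> 'a \<Rightarrow> 'a" where
  "f_poly x y z = x^3 + x^2 * y + x * y^2 + x^2 * z + x * z^2"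

definition F_map :: "'a::field \<times> 'a \<times> 'a \<Rightarrow> 'a \<times> 'a \<times> 'a" where
  "F_map = (\<lambda>(x, y, z). (f_poly x y z, f_poly y z x, f_poly z x y))"

end

theory Submission imports Defs begin

text \<open>
  In characteristic 2, with \<open>s = x + y + z\<close>, \<open>a = y + z\<close>, \<open>b = z + x\<close>, \<open>c = x + y\<close>, the components of
  \<open>F\<close> are \<open>a\<^sup>3 + s\<^sup>3\<close>, \<open>b\<^sup>3 + s\<^sup>3\<close>, \<open>c\<^sup>3 + s\<^sup>3\<close>, and \<open>a + b + c = 0\<close>. The quadratic form
  \<open>Q(a, b) = a\<^sup>2 + a b + b\<^sup>2\<close> is invariant under permuting \<open>a, b, c\<close>, so the pairwise sums of the
  components are \<open>a Q\<close>, \<open>b Q\<close>, \<open>c Q\<close>, and \<open>Q(a Q, b Q) = Q\<^sup>3\<close>. Since \<open>m\<close> is odd, \<open>3\<close> does not divide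
  \<open>2\<^sup>m - 1\<close>, so cubing is injective: the values of \<open>F\<close> determine \<open>Q\<close>, then \<open>a\<close> and \<open>b\<close>, then \<open>s\<close>.
\<close>

text \<open>Translation by 1 permutes the field, so summing all elements before and after it differs
  by \<open>CARD('a)\<close> copies of 1.\<close>

lemma of_nat_CARD_eq_0: "of_nat CARD('a) = (0 :: 'a :: {field, finite})"
proof -
  have "(\<Sum>x\<in>UNIV. x) = (\<Sum>x\<in>UNIV. x + (1 :: 'a))"
    by (rule sum.reindex_bij_witness[of _ "\<lambda>x. x + 1" "\<lambda>x. x - 1"]) auto
  then show ?thesis
    by (simp add: sum.distrib)
qed

text \<open>Multiplication by \<open>t\<close> permutes the nonzero elements, whose product is
  nonzero and can be cancelled.\<close>

lemma power_CARD_minus_1_eq_1: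
  fixes t :: "'a :: {field, finite}"
  assumes "t \<noteq> 0"
  shows "t ^ (CARD('a) - 1) = 1"
proof -
  let ?P = "\<Prod>x\<in>UNIV - {0::'a}. x"
  have "?P = (\<Prod>x\<in>UNIV - {0}. t * x)"
    by (rule prod.reindex_bij_witness[of _ "\<lambda>x. t * x" "\<lambda>x. x / t"]) (use assms in auto)
  also have "\<dots> = t ^ (CARD('a) - 1) * ?P"
    by (simp add: prod.distrib card_Diff_singleton)
  finally show ?thesis
    by simp
qed

lemma two_power_odd_minus_1_eq:
  assumes "odd m"
  obtains k where "(2::nat) ^ m - 1 = 3 * k + 1"
proof -
  obtain n where m: "m = 2 * n + 1"
    using assms by (rule oddE)
  have "(4::nat) ^ n mod 3 = 1"
    by (induction n) (auto simp: mod_mult_right_eq[symmetric] mod_Suc)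
  then have "(4::nat) ^ n = 3 * (4 ^ n div 3) + 1"
    using mult_div_mod_eq[of 3 "4 ^ n :: nat"] by simp
  then have "(2::nat) ^ m - 1 = 3 * (2 * (4 ^ n div 3)) + 1"
    unfolding m by (simp add: power_mult)
  then show thesis
    by (rule that)
qed

lemma cube_eq_iff_odd_degree:
  fixes x y :: "'a :: {field, finite}"
  assumes "odd m" and "CARD('a) = 2 ^ m"
  shows "x ^ 3 = y ^ 3 \<longleftrightarrow> x = y"
proof
  assume eq: "x ^ 3 = y ^ 3"
  show "x = y"
  proof (cases "y = 0")
    case True
    then show ?thesis using eq by simp
  next
    case False
    define t where "t = x / y"
    have t3: "t ^ 3 = 1"
      using eq False by (simp add: t_def power_divide)
    then have "t \<noteq> 0"
      by auto
    moreover obtain k where "(2::nat) ^ m - 1 = 3 * k + 1"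
      using two_power_odd_minus_1_eq[OF assms(1)] .
    \<comment> \<open>The exponent is the order of the multiplicative group; being 1 modulo 3, it
      reduces this power to \<open>t\<close> itself.\<close>
    ultimately have "t ^ (3 * k + 1) = 1"
      using power_CARD_minus_1_eq_1[of t] assms(2) by simp
    then have "t = 1"
      using t3 by (simp add: power_mult)
    then show ?thesis
      using False by (simp add: t_def)
  qed
qed simp

lemma f_poly_eq_cubes:
  fixes x y z :: "'a :: field"
  assumes "(2::'a) = 0"
  shows "f_poly x y z = (y + z) ^ 3 + (x + y + z) ^ 3"
proof -
  \<comment> \<open>With the multiple of 2 written out, this is a polynomial identity over any
    field.\<close>
  have "(y + z) ^ 3 + (x + y + z) ^ 3 =
      f_poly x y z + 2 * ((y + z) ^ 3 + x ^ 2 * (y + z) + x * (y ^ 2 + z ^ 2 + 3 * y * z))"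
    unfolding f_poly_def by algebra
  then show ?thesis
    using assms by simp
qed

lemma cubes_determine_summands:
  fixes a b s a' b' s' :: "'a :: field"
  assumes two: "(2::'a) = 0"
    and cube: "\<And>x y :: 'a. x ^ 3 = y ^ 3 \<longleftrightarrow> x = y"
    and u: "a ^ 3 + s ^ 3 = a' ^ 3 + s' ^ 3"
    and v: "b ^ 3 + s ^ 3 = b' ^ 3 + s' ^ 3"
    and w: "(a + b) ^ 3 + s ^ 3 = (a' + b') ^ 3 + s' ^ 3"
  shows "a = a' \<and> b = b' \<and> s = s'"
proof -
  define Q where "Q a b = a ^ 2 + a * b + b ^ 2" for a b :: 'a
  have Q_mult: "Q (a * q) (b * q) = Q a b * q ^ 2" for a b q
    unfolding Q_def by algebra
  have Q_anisotropic: "a = 0 \<and> b = 0" if "Q a b = 0" for a b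
  proof -
    \<comment> \<open>This uses a^3 - b^3 = (a - b) Q(a, b); once a = b, the form becomes 3 a^2 =
      a^2.\<close>
    have "a ^ 3 = b ^ 3"
      using that unfolding Q_def by algebra
    then have "a = b"
      using cube by simp
    then show ?thesis
      using that two by (auto simp: Q_def power2_eq_square)
  qed
  have Q_commute: "Q a b = Q b a" for a b
    unfolding Q_def by algebra
  have mult_Q: "a * Q a b = (a + b) ^ 3 - b ^ 3" for a b
  proof -
    have "(a + b) ^ 3 - b ^ 3 = a * Q a b + 2 * (a ^ 2 * b + a * b ^ 2)"
      unfolding Q_def by algebra
    then show ?thesis
      using two by simp
  qed
  have aQ: "a * Q a b = a' * Q a' b'"
    unfolding mult_Q using v w by algebra
  have bQ: "b * Q a b = b' * Q a' b'"
    unfolding Q_commute[of a] Q_commute[of a'] mult_Q using u w by algebra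
  \<comment> \<open>Take q = Q(a, b) in \<open>Q_mult\<close>: the form at the known products
    \<open>aQ\<close>, \<open>bQ\<close> is the cube of Q(a, b).\<close>
  have "Q a b ^ 3 = Q a' b' ^ 3"
    using Q_mult[of a "Q a b" b] Q_mult[of a' "Q a' b'" b'] aQ bQ
    by (simp add: power3_eq_cube power2_eq_square mult.assoc)
  then have Q_eq: "Q a b = Q a' b'"
    using cube by simp
  have ab: "a = a' \<and> b = b'"
  proof (cases "Q a b = 0")
    case True
    then show ?thesis
      using Q_anisotropic[of a b] Q_anisotropic[of a' b'] Q_eq by simp
  next
    case False
    then show ?thesis using aQ bQ Q_eq by simp
  qed
  with u have "s ^ 3 = s' ^ 3"
    by simp
  with ab show ?thesis
    using cube by simp
qed

theorem theorem5:
  fixes m :: nat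
  assumes "odd m"
    and "CARD('a::{field, finite}) = 2 ^ m"
  shows "bij (F_map :: 'a \<times> 'a \<times> 'a \<Rightarrow> 'a \<times> 'a \<times> 'a)"
proof -
  \<comment> \<open>The cardinality vanishes in the field, so 2^m = 0 there, and a field has no
    nilpotents.\<close>
  have two: "(2::'a) = 0"
    using of_nat_CARD_eq_0[where 'a = 'a] assms by simp
  have "inj (F_map :: 'a \<times> 'a \<times> 'a \<Rightarrow> 'a \<times> 'a \<times> 'a)"
  proof (rule injI)
    fix p q :: "'a \<times> 'a \<times> 'a"
    assume eq: "F_map p = F_map q"
    obtain x y z x' y' z' where p: "p = (x, y, z)" and q: "q = (x', y', z')"
      by (metis prod.exhaust)
    from eq have
      u: "(y + z) ^ 3 + (x + y + z) ^ 3 = (y' + z') ^ 3 + (x' + y' + z') ^ 3" and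
      v: "(z + x) ^ 3 + (x + y + z) ^ 3 = (z' + x') ^ 3 + (x' + y' + z') ^ 3" and
      w: "(x + y) ^ 3 + (x + y + z) ^ 3 = (x' + y') ^ 3 + (x' + y' + z') ^ 3"
      by (simp_all add: p q F_map_def f_poly_eq_cubes[OF two] ac_simps)
    have c: "(y + z) + (z + x) = x + y" for x y z :: 'a
    proof -
      have "(y + z) + (z + x) = x + y + 2 * z"
        by algebra
      then show ?thesis
        using two by simp
    qed
    have *: "y + z = y' + z' \<and> z + x = z' + x' \<and> x + y + z = x' + y' + z'"
      by (rule cubes_determine_summands[OF two cube_eq_iff_odd_degree[OF assms] u v])
         (unfold c, rule w)
    then have "x = x'" "y = y'"
      by (auto simp: add.assoc)
    with * show "p = q"
      by (simp add: p q)
  qed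
  then show ?thesis
    by (simp add: bij_def finite_UNIV_inj_surj)
qed

end
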